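(* Let $K$ be a field. For all natural numbers $d,l$ there exists a natural number $M$ such that for every sequence $I_0,\dots,I_M$ of monomial ideals in $K[X_d,\dots,X_0,Y]$ with $\mathrm{deg}(I_i)\le l+i$ for all $i\le M$, there exist $i<j\le M$ with $I_i\supseteq I_j$.
   Context: A monomial in $K[X_d,\dots,X_0,Y]$ is a polynomial of the form $X_d^{i_d}\cdots X_0^{i_0}Y^j$; its degree is the total degree $i_d+\dots+i_0+j$. A monomial ideal is an ideal generated by monomials. The degree of a finite set $G$ of monomials is $\max\{\mathrm{deg}(m): m\in G\}$. The degree of a monomial ideal $I$ is $\mathrm{deg}(I)=\min\{\mathrm{deg}(G): G \text{ a finite set of monomials with } I=\langle G\rangle\}$. *)

theory Defs
  imports "HOL-Library.Poly_Mapping" "HOL-Algebra.Ideal"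
begin

datatype var = X nat | Y

type_synonym expo = "var \<Rightarrow>\<^sub>0 nat"
type_synonym 'k mpoly = "expo \<Rightarrow>\<^sub>0 'k"

definition vars :: "nat \<Rightarrow> var set" where
  "vars d = insert Y (X ` {..d})"

text \<open>The ring \<open>K[X\<^sub>d, \<dots>, X\<^sub>0, Y]\<close>, where \<open>K\<close> is the field given by the type \<open>'k\<close>.\<close>

definition poly_ring :: "nat \<Rightarrow> 'k::field mpoly ring" where
  "poly_ring d =
     \<lparr>carrier = {p. \<forall>e \<in> Poly_Mapping.keys p. Poly_Mapping.keys e \<subseteq> vars d},
      mult = (*), one = 1, zero = 0, add = (+)\<rparr>"

definition monomials :: "nat \<Rightarrow> 'k::field mpoly set" where
  "monomials d = (\<lambda>e. Poly_Mapping.single e 1) ` {e. Poly_Mapping.keys e \<subseteq> vars d}"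

definition monomial_ideal :: "nat \<Rightarrow> 'k::field mpoly set \<Rightarrow> bool" where
  "monomial_ideal d I \<longleftrightarrow> (\<exists>G \<subseteq> monomials d. I = Idl\<^bsub>poly_ring d\<^esub> G)"

definition expo_degree :: "expo \<Rightarrow> nat" where
  "expo_degree e = (\<Sum>v \<in> Poly_Mapping.keys e. Poly_Mapping.lookup e v)"

text \<open>The total degree of a polynomial; it is only applied to monomials below, where it is the
  sum of the exponents.\<close>

definition total_degree :: "'k::field mpoly \<Rightarrow> nat" where
  "total_degree p = Max (insert 0 (expo_degree ` Poly_Mapping.keys p))"

text \<open>The empty set of monomials, which generates the zero ideal, gets degree 0.\<close>

definition set_degree :: "'k::field mpoly set \<Rightarrow> nat" where
  "set_degree G = Max (insert 0 (total_degree ` G))"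

definition ideal_degree :: "nat \<Rightarrow> 'k::field mpoly set \<Rightarrow> nat" where
  "ideal_degree d I =
     (LEAST n. \<exists>G. finite G \<and> G \<subseteq> monomials d \<and> I = Idl\<^bsub>poly_ring d\<^esub> G \<and> n = set_degree G)"

lemma total_degree_monomial:
  "total_degree (Poly_Mapping.single e (1::'k::field)) = expo_degree e"
  by (simp add: total_degree_def)

lemma keys_expo_add:
  fixes a b :: expo
  shows "Poly_Mapping.keys (a + b) = Poly_Mapping.keys a \<union> Poly_Mapping.keys b"
  by (auto simp: in_keys_iff lookup_add)

lemma poly_ring_closed:
  fixes p q :: "'k::field mpoly"
  assumes "p \<in> carrier (poly_ring d)" "q \<in> carrier (poly_ring d)"
  shows "p + q \<in> carrier (poly_ring d)" "p * q \<in> carrier (poly_ring d)"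
proof -
  show "p + q \<in> carrier (poly_ring d)"
    using Poly_Mapping.keys_add[of p q] assms unfolding poly_ring_def by fastforce
  have "Poly_Mapping.keys e \<subseteq> vars d" if e: "e \<in> Poly_Mapping.keys (p * q)" for e
  proof -
    obtain a b where "a \<in> Poly_Mapping.keys p" "b \<in> Poly_Mapping.keys q" "e = a + b"
      using keys_mult[of p q] e by blast
    then show ?thesis using assms by (simp add: keys_expo_add poly_ring_def)
  qed
  then show "p * q \<in> carrier (poly_ring d)" by (simp add: poly_ring_def)
qed

lemma poly_ring_simps:
  "x \<otimes>\<^bsub>poly_ring d\<^esub> y = x * y" "x \<oplus>\<^bsub>poly_ring d\<^esub> y = x + y"
  "\<one>\<^bsub>poly_ring d\<^esub> = 1" "\<zero>\<^bsub>poly_ring d\<^esub> = 0"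
  by (simp_all add: poly_ring_def)

lemma poly_ring_consts:
  "0 \<in> carrier (poly_ring d)" "1 \<in> carrier (poly_ring d)"
  "p \<in> carrier (poly_ring d) \<Longrightarrow> - p \<in> carrier (poly_ring d)"
  by (simp_all add: poly_ring_def)

lemma cring_poly_ring: "cring (poly_ring d :: 'k::field mpoly ring)"
proof (rule cringI)
  show "abelian_group (poly_ring d :: 'k mpoly ring)"
  proof (rule abelian_groupI)
    fix p :: "'k mpoly" assume "p \<in> carrier (poly_ring d)"
    then show "\<exists>q \<in> carrier (poly_ring d). q \<oplus>\<^bsub>poly_ring d\<^esub> p = \<zero>\<^bsub>poly_ring d\<^esub>"
      by (intro bexI[of _ "- p"]) (simp_all add: poly_ring_simps poly_ring_consts)
  qed (simp_all add: poly_ring_simps poly_ring_consts poly_ring_closed ac_simps)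
  show "comm_monoid (poly_ring d :: 'k mpoly ring)"
    by (rule comm_monoidI)
      (simp_all add: poly_ring_simps poly_ring_consts poly_ring_closed ac_simps)
qed (simp add: poly_ring_simps distrib_right)

end

theory Submission
  imports Defs "HOL-Library.Extended_Nat"
begin

text \<open>
  The exponents of the monomials outside a finitely generated monomial ideal form a finite union of
  boxes, each given by a vector of bounds in \<open>\<nat> \<union> {\<infinity>}\<close>. Hence a sequence of ideals, no earlier one
  containing a later one, yields a sequence of finite sets of bound vectors, no earlier one dominated
  by a later one. By the pigeonhole principle and a diagonal argument one can select, along a
  subsequence, a member of each of these sets that is not dominated by any member of the later sets;
  the selected vectors contradict Dickson's lemma over \<open>\<nat> \<union> {\<infinity>}\<close>. Thus there is no infinite bad
  sequence. As only finitely many monomial ideals have degree at most \<open>l + i\<close>, Koenig's lemma bounds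
  the length of the bad sequences in question.
\<close>

section \<open>Dickson's lemma for vectors over a well-order\<close>

lemma wellorder_mono_subseq:
  fixes s :: "nat \<Rightarrow> 'a::wellorder"
  shows "\<exists>\<phi>::nat \<Rightarrow> nat. strict_mono \<phi> \<and> (\<forall>i j. i \<le> j \<longrightarrow> s (\<phi> i) \<le> s (\<phi> j))"
proof -
  have least: "\<exists>m\<ge>n. \<forall>k\<ge>n. s m \<le> s k" for n
  proof -
    define x where "x = (LEAST x. x \<in> s ` {n..})"
    have "x \<in> s ` {n..}" unfolding x_def by (rule LeastI[of _ "s n"]) simp
    moreover have "x \<le> s k" if "k \<ge> n" for k unfolding x_def using that by (intro Least_le) simp
    ultimately show ?thesis by auto
  qed
  \<comment> \<open>Each chosen position minimises \<open>s\<close> over the tail that starts there.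
    Later choices lie in that tail, so the values never decrease.\<close>
  have "\<exists>\<phi>. \<forall>n. (\<forall>k\<ge>\<phi> n. s (\<phi> n) \<le> s k) \<and> \<phi> n < \<phi> (Suc n)"
  proof (rule dependent_nat_choice)
    show "\<exists>m. \<forall>k\<ge>m. s m \<le> s k" using least[of 0] by auto
    show "\<exists>m'. (\<forall>k\<ge>m'. s m' \<le> s k) \<and> m < m'" for m
      using least[of "Suc m"] by (metis Suc_le_eq le_trans)
  qed
  then obtain \<phi> where \<phi>: "\<And>n k. k \<ge> \<phi> n \<Longrightarrow> s (\<phi> n) \<le> s k" "\<And>n. \<phi> n < \<phi> (Suc n)" by blast
  then have "strict_mono \<phi>" by (simp add: strict_mono_Suc_iff)
  with \<phi>(1) show ?thesis by (meson strict_mono_less_eq)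
qed

text \<open>Coordinates are treated one at a time: thinning out a subsequence keeps the monotonicity
  already reached. A general well-order covers both uses, exponents in \<open>nat\<close> and box
  bounds in \<open>enat\<close>.\<close>

lemma dickson_subseq:
  fixes f :: "nat \<Rightarrow> 'v \<Rightarrow> 'a::wellorder"
  assumes "finite V"
  shows "\<exists>\<phi>::nat \<Rightarrow> nat. strict_mono \<phi> \<and> (\<forall>v\<in>V. \<forall>i j. i \<le> j \<longrightarrow> f (\<phi> i) v \<le> f (\<phi> j) v)"
  using assms
proof (induction V)
  case empty
  show ?case by (rule exI[of _ id]) (simp add: strict_mono_def)
next
  case (insert w V)
  then obtain \<phi> :: "nat \<Rightarrow> nat"
    where \<phi>: "strict_mono \<phi>" "\<forall>v\<in>V. \<forall>i j. i \<le> j \<longrightarrow> f (\<phi> i) v \<le> f (\<phi> j) v" by blast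
  obtain \<psi> :: "nat \<Rightarrow> nat"
    where \<psi>: "strict_mono \<psi>" "\<forall>i j. i \<le> j \<longrightarrow> f (\<phi> (\<psi> i)) w \<le> f (\<phi> (\<psi> j)) w"
    using wellorder_mono_subseq[of "\<lambda>n. f (\<phi> n) w"] by blast
  show ?case
  proof (intro exI[of _ "\<phi> \<circ> \<psi>"] conjI ballI allI impI)
    show "strict_mono (\<phi> \<circ> \<psi>)" using \<phi>(1) \<psi>(1) by (simp add: strict_mono_o)
    fix i j :: nat and u assume "u \<in> insert w V" "i \<le> j"
    then show "f ((\<phi> \<circ> \<psi>) i) u \<le> f ((\<phi> \<circ> \<psi>) j) u"
      using \<phi>(2) \<psi> by (auto simp: strict_mono_less_eq)
  qed
qed

corollary dickson:
  fixes f :: "nat \<Rightarrow> 'v \<Rightarrow> 'a::wellorder"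
  assumes "finite V"
  shows "\<exists>i j. i < j \<and> (\<forall>v\<in>V. f i v \<le> f j v)"
proof -
  obtain \<phi> :: "nat \<Rightarrow> nat"
    where \<phi>: "strict_mono \<phi>" "\<forall>v\<in>V. \<forall>i j. i \<le> j \<longrightarrow> f (\<phi> i) v \<le> f (\<phi> j) v"
    using dickson_subseq[OF assms] by blast
  have "\<phi> 0 < \<phi> 1" using \<phi>(1) by (simp add: strict_mono_less)
  with \<phi>(2) show ?thesis by (intro exI[of _ "\<phi> 0"] exI[of _ "\<phi> 1"]) simp
qed

text \<open>If no finite subset sufficed, one could keep choosing a vector of \<open>E\<close> above
  none of the earlier ones, against \<open>dickson\<close>.\<close>

lemma dickson_finite_basis:
  fixes E :: "('v \<Rightarrow> 'a::wellorder) set"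
  assumes "finite V"
  shows "\<exists>E0\<subseteq>E. finite E0 \<and> (\<forall>e\<in>E. \<exists>e'\<in>E0. \<forall>v\<in>V. e' v \<le> e v)"
proof (rule ccontr)
  assume no: "\<not> ?thesis"
  have "\<exists>f::nat \<Rightarrow> 'v \<Rightarrow> 'a. \<forall>n. f n \<in> E \<and> (\<forall>m<n. \<not> (\<forall>v\<in>V. f m v \<le> f n v))"
  proof (rule dependent_wellorder_choice)
    fix n and f :: "nat \<Rightarrow> 'v \<Rightarrow> 'a"
    assume "\<And>m. m < n \<Longrightarrow> f m \<in> E \<and> (\<forall>k<m. \<not> (\<forall>v\<in>V. f k v \<le> f m v))"
    then have "f ` {..<n} \<subseteq> E" by auto
    then have "\<exists>e\<in>E. \<forall>e'\<in>f ` {..<n}. \<not> (\<forall>v\<in>V. e' v \<le> e v)"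
      using no by (meson finite_imageI finite_lessThan)
    then show "\<exists>e. e \<in> E \<and> (\<forall>m<n. \<not> (\<forall>v\<in>V. f m v \<le> e v))" by blast
  qed simp
  then obtain f :: "nat \<Rightarrow> 'v \<Rightarrow> 'a" where "\<And>n m. m < n \<Longrightarrow> \<not> (\<forall>v\<in>V. f m v \<le> f n v)" by blast
  with dickson[OF assms, of f] show False by blast
qed

section \<open>Finite unions of boxes\<close>

text \<open>In a counterexample, each \<open>F i\<close> has for every later \<open>j\<close> an
  element that fails against all of \<open>F j\<close>. This element depends on \<open>j\<close>,
  but as \<open>F i\<close> is finite, one element serves infinitely many \<open>j\<close>.
  Restricting to these \<open>j\<close> and repeating gives a sequence that contradicts
  \<open>af\<close>.\<close>

lemma finite_sets_dominated:
  fixes R :: "'a \<Rightarrow> 'a \<Rightarrow> bool" and F :: "nat \<Rightarrow> 'a set"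
  assumes af: "\<And>f::nat \<Rightarrow> 'a. \<exists>i j. i < j \<and> R (f i) (f j)"
    and fin: "\<And>i. finite (F i)"
  shows "\<exists>i j. i < j \<and> (\<forall>a\<in>F i. \<exists>b\<in>F j. R a b)"
proof (rule ccontr)
  assume bad: "\<not> ?thesis"
  \<comment> \<open>The indices still available after \<open>a\<close> has been selected from
    \<open>F i\<close>.\<close>
  define T where "T S i a = {j\<in>S. i < j \<and> (\<forall>b\<in>F j. \<not> R a b)}" for S :: "nat set" and i a
  have step: "\<exists>i a. i \<in> S \<and> a \<in> F i \<and> infinite (T S i a)" if inf: "infinite S" for S
  proof -
    obtain i where i: "i \<in> S" using inf by fastforce
    have "\<exists>a\<in>F i. \<forall>b\<in>F j. \<not> R a b" if "i < j" for j using bad that by blast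
    then have "{j\<in>S. i < j} \<subseteq> (\<Union>a\<in>F i. T S i a)" unfolding T_def by blast
    moreover have "infinite {j\<in>S. i < j}"
    proof
      assume "finite {j\<in>S. i < j}"
      then have "finite ({j\<in>S. i < j} \<union> {..i})" by simp
      moreover have "S \<subseteq> {j\<in>S. i < j} \<union> {..i}" by auto
      ultimately show False using inf finite_subset by blast
    qed
    ultimately have "infinite (\<Union>a\<in>F i. T S i a)" by (meson finite_subset)
    then show ?thesis using fin i by blast
  qed
  define P where "P = (\<lambda>(S, i, a). infinite S \<and> i \<in> S \<and> a \<in> F i \<and> infinite (T S i a))"
  have "\<exists>s. \<forall>n. P (s n) \<and> (case s n of (S, i, a) \<Rightarrow> fst (s (Suc n)) = T S i a)"
  proof (rule dependent_nat_choice)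
    show "\<exists>x. P x" using step[of UNIV] by (auto simp: P_def)
    fix x :: "nat set \<times> nat \<times> 'a" assume "P x"
    then obtain S i a where x: "x = (S, i, a)" "infinite (T S i a)" unfolding P_def by auto
    obtain i' a' where "i' \<in> T S i a" "a' \<in> F i'" "infinite (T (T S i a) i' a')"
      using step[OF x(2)] by blast
    then show "\<exists>y. P y \<and> (case x of (S, i, a) \<Rightarrow> fst y = T S i a)"
      using x by (intro exI[of _ "(T S i a, i', a')"]) (simp add: P_def)
  qed
  then obtain s where "\<forall>n. P (s n) \<and> (case s n of (S, i, a) \<Rightarrow> fst (s (Suc n)) = T S i a)" ..
  then have s: "P (s n)" "case s n of (S, i, a) \<Rightarrow> fst (s (Suc n)) = T S i a" for n by simp_all
  define S i a where "S n = fst (s n)" and "i n = fst (snd (s n))" and "a n = snd (snd (s n))" for n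
  have P: "i n \<in> S n" "a n \<in> F (i n)" for n
    using s(1)[of n] by (auto simp: P_def S_def i_def a_def split: prod.splits)
  have S_Suc: "S (Suc n) = T (S n) (i n) (a n)" for n
    using s(2)[of n] by (auto simp: S_def i_def a_def split: prod.splits)
  have anti: "S n \<subseteq> S m" if "m \<le> n" for m n
    using that by (rule lift_Suc_antimono_le[rotated]) (auto simp: S_Suc T_def)
  have "\<not> R (a m) (a n)" if "m < n" for m n
  proof -
    \<comment> \<open>The index sets are nested, so every later index survives the restriction made
      when \<open>a m\<close> was selected.\<close>
    have "i n \<in> S (Suc m)" using P(1) anti[of "Suc m" n] that by (meson Suc_leI subsetD)
    then show ?thesis using P(2)[of n] unfolding S_Suc T_def by blast
  qed
  then show False using af[of a] by blast
qed

text \<open>A point avoids a new generator \<open>e\<close> iff it is below \<open>e\<close> in some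
  coordinate \<open>w\<close>. So each old box is replaced by its truncations at
  \<open>e w - 1\<close>, one for each suitable \<open>w\<close>.\<close>

lemma avoided_box_union:
  fixes E :: "('v \<Rightarrow> nat) set"
  assumes "finite V" "finite E"
  shows "\<exists>B::('v \<Rightarrow> enat) set. finite B \<and>
    (\<forall>x. (\<exists>e\<in>E. \<forall>v\<in>V. e v \<le> x v) \<longleftrightarrow> \<not> (\<exists>b\<in>B. \<forall>v\<in>V. enat (x v) \<le> b v))"
  using assms(2)
proof (induction E)
  case empty
  show ?case by (rule exI[of _ "{\<lambda>_. \<infinity>}"]) simp
next
  case (insert e E)
  then obtain B :: "('v \<Rightarrow> enat) set" where B: "finite B"
    "\<And>x. (\<exists>e\<in>E. \<forall>v\<in>V. e v \<le> x v) \<longleftrightarrow> \<not> (\<exists>b\<in>B. \<forall>v\<in>V. enat (x v) \<le> b v)" by blast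
  \<comment> \<open>Coordinates with \<open>e w = 0\<close> must be left out: no point lies below
    \<open>e\<close> there, yet truncated subtraction would give the bound 0 and admit
    points.\<close>
  define C where "C = (\<lambda>(b, w). b(w := min (b w) (enat (e w - 1)))) ` (B \<times> {w\<in>V. e w > 0})"
  have "(\<exists>c\<in>C. \<forall>v\<in>V. enat (x v) \<le> c v) \<longleftrightarrow>
      (\<exists>b\<in>B. \<forall>v\<in>V. enat (x v) \<le> b v) \<and> (\<exists>w\<in>V. x w < e w)" (is "?L \<longleftrightarrow> ?R") for x
  proof
    assume ?L
    then obtain b w where bw: "b \<in> B" "w \<in> V" "e w > 0"
      "\<forall>v\<in>V. enat (x v) \<le> (b(w := min (b w) (enat (e w - 1)))) v"
      unfolding C_def by auto
    have "enat (x w) \<le> min (b w) (enat (e w - 1))" using bw(2,4) by (metis fun_upd_same)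
    then have w: "enat (x w) \<le> b w" "x w < e w" using bw(3) by auto
    have "enat (x v) \<le> b v" if "v \<in> V" for v
      using bw(4) that w(1) by (cases "v = w") (auto dest!: bspec)
    then show ?R using bw w by blast
  next
    assume ?R
    then obtain b w where bw: "b \<in> B" "\<forall>v\<in>V. enat (x v) \<le> b v" "w \<in> V" "x w < e w" by blast
    then have "b(w := min (b w) (enat (e w - 1))) \<in> C"
      unfolding C_def by (intro image_eqI[of _ _ "(b, w)"]) auto
    moreover have "\<forall>v\<in>V. enat (x v) \<le> (b(w := min (b w) (enat (e w - 1)))) v"
      using bw by auto
    ultimately show ?L by blast
  qed
  moreover have "finite C" unfolding C_def using B(1) assms(1) by simp
  ultimately show ?case using B(2) by (intro exI[of _ C]) (auto simp: not_le)
qed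

text \<open>Complementation reverses inclusion. If every box of the complement for \<open>i\<close>
  lies in a box of the complement for \<open>j\<close>, the up-set of \<open>E j\<close> is
  contained in that of \<open>E i\<close>.\<close>

lemma generated_upsets_descend:
  fixes E :: "nat \<Rightarrow> ('v \<Rightarrow> nat) set"
  assumes V: "finite V" and E: "\<And>i. finite (E i)"
  shows "\<exists>i j. i < j \<and> (\<forall>e\<in>E j. \<exists>e'\<in>E i. \<forall>v\<in>V. e' v \<le> e v)"
proof -
  have "\<forall>i. \<exists>B::('v \<Rightarrow> enat) set. finite B \<and>
    (\<forall>x. (\<exists>e\<in>E i. \<forall>v\<in>V. e v \<le> x v) \<longleftrightarrow> \<not> (\<exists>b\<in>B. \<forall>v\<in>V. enat (x v) \<le> b v))"
    using avoided_box_union[OF V E] by (rule allI)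
  from choice[OF this] obtain B :: "nat \<Rightarrow> ('v \<Rightarrow> enat) set" where "\<forall>i. finite (B i) \<and>
    (\<forall>x. (\<exists>e\<in>E i. \<forall>v\<in>V. e v \<le> x v) \<longleftrightarrow> \<not> (\<exists>b\<in>B i. \<forall>v\<in>V. enat (x v) \<le> b v))" ..
  then have B: "finite (B i)"
    "(\<exists>e\<in>E i. \<forall>v\<in>V. e v \<le> x v) \<longleftrightarrow> \<not> (\<exists>b\<in>B i. \<forall>v\<in>V. enat (x v) \<le> b v)" for i x
    by simp_all
  obtain i j where ij: "i < j" "\<forall>a\<in>B i. \<exists>b\<in>B j. \<forall>v\<in>V. a v \<le> b v"
    using finite_sets_dominated[of "\<lambda>a b. \<forall>v\<in>V. a v \<le> b v" B] dickson[OF V] B(1) by blast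
  have "\<exists>e'\<in>E i. \<forall>v\<in>V. e' v \<le> e v" if "e \<in> E j" for e
  proof (rule ccontr)
    assume "\<not> ?thesis"
    then obtain a where "a \<in> B i" "\<forall>v\<in>V. enat (e v) \<le> a v" using B(2) by blast
    then have "\<exists>b\<in>B j. \<forall>v\<in>V. enat (e v) \<le> b v" using ij(2) by (meson order_trans)
    then show False using B(2)[of j e] that by blast
  qed
  with ij(1) show ?thesis by blast
qed

section \<open>Koenig's lemma\<close>

text \<open>An infinite set of rows \<open>M\<close> agreeing on the entries so far is thinned out,
  by pigeonhole in the finite set \<open>A n\<close>, to an infinite set of rows that also agree at
  the next entry. The common entries form \<open>g\<close>.\<close>

lemma koenig_sequences:
  fixes A :: "nat \<Rightarrow> 'a set" and f :: "nat \<Rightarrow> nat \<Rightarrow> 'a"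
  assumes fin: "\<And>i. finite (A i)" and f: "\<And>M i. i \<le> M \<Longrightarrow> f M i \<in> A i"
  shows "\<exists>g. \<forall>n. \<exists>M\<ge>n. \<forall>i\<le>n. f M i = g i"
proof -
  have step: "\<exists>a. infinite {M\<in>S. f M n = a}" if "infinite S" for S n
  proof -
    \<comment> \<open>Row \<open>M\<close> is controlled only up to entry \<open>M\<close>; the
      finite set \<open>{..n}\<close> absorbs the rows too short to have a controlled entry
      \<open>n\<close>.\<close>
    have "S \<subseteq> {..n} \<union> (\<Union>a\<in>A n. {M\<in>S. f M n = a})" 
    proof
      fix M assume "M \<in> S"
      then show "M \<in> {..n} \<union> (\<Union>a\<in>A n. {M\<in>S. f M n = a})" using f[of n M] by (cases "M \<le> n") auto
    qed
    then have "infinite ({..n} \<union> (\<Union>a\<in>A n. {M\<in>S. f M n = a}))" using that finite_subset by blast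
    then show ?thesis using fin by auto
  qed
  have "\<exists>s. \<forall>n. (infinite (fst (s n)) \<and> (\<forall>M\<in>fst (s n). f M n = snd (s n))) \<and>
      fst (s (Suc n)) \<subseteq> fst (s n)"
  proof (rule dependent_nat_choice)
    obtain a where "infinite {M\<in>UNIV. f M 0 = a}" using step[of UNIV 0] by auto
    then show "\<exists>x. infinite (fst x) \<and> (\<forall>M\<in>fst x. f M 0 = snd x)"
      by (intro exI[of _ "({M\<in>UNIV. f M 0 = a}, a)"]) auto
    fix x :: "nat set \<times> 'a" and n
    assume "infinite (fst x) \<and> (\<forall>M\<in>fst x. f M n = snd x)"
    then obtain a where "infinite {M\<in>fst x. f M (Suc n) = a}" using step[of "fst x"] by blast
    then show "\<exists>y. (infinite (fst y) \<and> (\<forall>M\<in>fst y. f M (Suc n) = snd y)) \<and> fst y \<subseteq> fst x"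
      by (intro exI[of _ "({M\<in>fst x. f M (Suc n) = a}, a)"]) auto
  qed
  then obtain s where "\<forall>n. (infinite (fst (s n)) \<and> (\<forall>M\<in>fst (s n). f M n = snd (s n))) \<and>
      fst (s (Suc n)) \<subseteq> fst (s n)" ..
  then have s: "infinite (fst (s n))" "M \<in> fst (s n) \<Longrightarrow> f M n = snd (s n)"
    "fst (s (Suc n)) \<subseteq> fst (s n)" for n M by simp_all
  have anti: "fst (s n) \<subseteq> fst (s m)" if "m \<le> n" for m n
    using that by (rule lift_Suc_antimono_le[rotated]) (rule s(3))
  show ?thesis
  proof (intro exI[of _ "\<lambda>n. snd (s n)"] allI)
    fix n
    obtain M where "M \<ge> n" "M \<in> fst (s n)"
      using s(1)[of n] by (meson infinite_nat_iff_unbounded_le)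
    then show "\<exists>M\<ge>n. \<forall>i\<le>n. f M i = snd (s i)" using s(2) anti by blast
  qed
qed

section \<open>Monomial ideals and their exponents\<close>

lemma finite_vars: "finite (vars d)"
  by (simp add: vars_def)

text \<open>Componentwise comparison of exponents is divisibility, so each generator from
  \<open>E'\<close> is a multiple of one from \<open>E\<close>.\<close>

lemma genideal_monomials_mono:
  fixes E E' :: "expo set"
  assumes E: "\<And>e. e \<in> E \<Longrightarrow> Poly_Mapping.keys e \<subseteq> vars d"
    and E': "\<And>e. e \<in> E' \<Longrightarrow> Poly_Mapping.keys e \<subseteq> vars d"
    and dom: "\<And>e. e \<in> E' \<Longrightarrow>
      \<exists>e'\<in>E. \<forall>v\<in>vars d. Poly_Mapping.lookup e' v \<le> Poly_Mapping.lookup e v"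
  shows "Idl\<^bsub>poly_ring d\<^esub> ((\<lambda>e. Poly_Mapping.single e (1::'k::field)) ` E')
    \<subseteq> Idl\<^bsub>poly_ring d\<^esub> ((\<lambda>e. Poly_Mapping.single e 1) ` E)"
proof -
  interpret cring "poly_ring d :: 'k mpoly ring" by (rule cring_poly_ring)
  let ?m = "\<lambda>e. Poly_Mapping.single e (1::'k)"
  let ?I = "Idl\<^bsub>poly_ring d\<^esub> (?m ` E)"
  have sub: "?m ` E \<subseteq> carrier (poly_ring d)" using E by (fastforce simp: poly_ring_def)
  have I: "ideal ?I (poly_ring d)" using genideal_ideal[OF sub] .
  have "?m e \<in> ?I" if e: "e \<in> E'" for e
  proof -
    obtain e' where e': "e' \<in> E"
      "\<forall>v\<in>vars d. Poly_Mapping.lookup e' v \<le> Poly_Mapping.lookup e v" using dom[OF e] by blast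
    \<comment> \<open>Outside \<open>vars d\<close> the exponent \<open>e'\<close> vanishes. With
      the inequality at every variable, the truncated difference \<open>e - e'\<close> is
      exact.\<close>
    have "Poly_Mapping.lookup e' v \<le> Poly_Mapping.lookup e v" for v
    proof (cases "v \<in> vars d")
      case False
      then have "v \<notin> Poly_Mapping.keys e'" using E[OF e'(1)] by blast
      then show ?thesis by (simp add: in_keys_iff)
    qed (use e'(2) in blast)
    then have split: "e = (e - e') + e'"
      by (intro poly_mapping_eqI) (simp add: lookup_add lookup_minus)
    have "Poly_Mapping.keys (e - e') \<subseteq> vars d"
      using E'[OF e] by (auto simp: in_keys_iff lookup_minus)
    then have "?m (e - e') \<in> carrier (poly_ring d)" by (simp add: poly_ring_def)
    moreover have "?m e' \<in> ?I" using genideal_self[OF sub] e'(1) by blast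
    ultimately have "?m (e - e') \<otimes>\<^bsub>poly_ring d\<^esub> ?m e' \<in> ?I"
      using ideal.I_l_closed[OF I] by blast
    then have "?m (e - e') * ?m e' \<in> ?I" by (simp only: poly_ring_simps)
    then show ?thesis using split by (simp add: mult_single)
  qed
  then show ?thesis by (intro genideal_minimal[OF I]) auto
qed

text \<open>The generating set in \<open>monomial_ideal\<close> may be infinite. Dickson's lemma on
  its exponents leaves finitely many generators, one of which divides any given generator.\<close>

lemma monomial_ideal_finitely_generated:
  fixes I :: "'k::field mpoly set"
  assumes "monomial_ideal d I"
  shows "\<exists>G. finite G \<and> G \<subseteq> monomials d \<and> I = Idl\<^bsub>poly_ring d\<^esub> G"
proof -
  let ?m = "\<lambda>e. Poly_Mapping.single e (1::'k)"
  obtain G where G: "G \<subseteq> monomials d" "I = Idl\<^bsub>poly_ring d\<^esub> G"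
    using assms unfolding monomial_ideal_def by blast
  obtain E where E: "E \<subseteq> {e. Poly_Mapping.keys e \<subseteq> vars d}" "G = ?m ` E"
    using G(1) unfolding monomials_def by (meson subset_imageE)
  obtain L where L: "L \<subseteq> Poly_Mapping.lookup ` E" "finite L"
    "\<forall>e\<in>Poly_Mapping.lookup ` E. \<exists>e'\<in>L. \<forall>v\<in>vars d. e' v \<le> e v"
    using dickson_finite_basis[OF finite_vars, of "Poly_Mapping.lookup ` E" d] by blast
  then obtain E0 where E0: "E0 \<subseteq> E" "finite E0" "L = Poly_Mapping.lookup ` E0"
    by (meson finite_subset_image)
  have "I = Idl\<^bsub>poly_ring d\<^esub> (?m ` E0)"
    unfolding G(2) E(2)
  proof
    show "Idl\<^bsub>poly_ring d\<^esub> (?m ` E) \<subseteq> Idl\<^bsub>poly_ring d\<^esub> (?m ` E0)"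
      using E(1) E0 L(3) by (intro genideal_monomials_mono) auto
    show "Idl\<^bsub>poly_ring d\<^esub> (?m ` E0) \<subseteq> Idl\<^bsub>poly_ring d\<^esub> (?m ` E)"
      using E(1) E0(1) by (intro genideal_monomials_mono) auto
  qed
  then show ?thesis
    using E(1) E0 by (intro exI[of _ "?m ` E0"]) (auto simp: monomials_def)
qed

lemma finite_expos_bounded_degree:
  "finite {e. Poly_Mapping.keys e \<subseteq> vars d \<and> expo_degree e \<le> n}" (is "finite ?S")
proof -
  let ?F = "{f. \<forall>v. (v \<in> vars d \<longrightarrow> f v \<in> {..n}) \<and> (v \<notin> vars d \<longrightarrow> f v = 0)}"
  have le: "Poly_Mapping.lookup e v \<le> expo_degree e" for e v
    unfolding expo_degree_def
    by (cases "v \<in> Poly_Mapping.keys e") (auto simp: in_keys_iff intro!: member_le_sum)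
  have "Poly_Mapping.lookup ` ?S \<subseteq> ?F"
    using le by (auto simp: in_keys_iff intro: order_trans)
  moreover have "finite ?F" by (intro finite_set_of_finite_funs finite_vars) simp
  ultimately have "finite (Poly_Mapping.lookup ` ?S)" by (rule finite_subset)
  then show ?thesis by (rule finite_imageD) (simp add: inj_on_def)
qed

lemma finite_monomial_ideals_bounded_degree:
  "finite {I :: 'k::field mpoly set. monomial_ideal d I \<and> ideal_degree d I \<le> n}"
proof -
  let ?m = "\<lambda>e. Poly_Mapping.single e (1::'k)"
  let ?S = "{e. Poly_Mapping.keys e \<subseteq> vars d \<and> expo_degree e \<le> n}"
  have "I \<in> (\<lambda>G. Idl\<^bsub>poly_ring d\<^esub> G) ` Pow (?m ` ?S)"
    if I: "monomial_ideal d I" "ideal_degree d I \<le> n" for I :: "'k mpoly set"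
  proof -
    \<comment> \<open>Finite generation makes the \<open>LEAST\<close> in
      \<open>ideal_degree\<close> attained. The generators attaining it come from the finitely many
      monomials of degree at most \<open>n\<close>.\<close>
    have "\<exists>k G. finite G \<and> G \<subseteq> monomials d \<and> I = Idl\<^bsub>poly_ring d\<^esub> G \<and> k = set_degree G"
      using monomial_ideal_finitely_generated[OF I(1)] by blast
    from LeastI_ex[OF this] obtain G where G: "finite G" "G \<subseteq> monomials d"
      "I = Idl\<^bsub>poly_ring d\<^esub> G" "ideal_degree d I = set_degree G"
      unfolding ideal_degree_def by blast
    have "g \<in> ?m ` ?S" if g: "g \<in> G" for g
    proof -
      obtain e where e: "Poly_Mapping.keys e \<subseteq> vars d" "g = ?m e"
        using G(2) g unfolding monomials_def by blast
      have "total_degree g \<le> set_degree G"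
        unfolding set_degree_def using G(1) g by (intro Max_ge) auto
      then show ?thesis using e I(2) G(4) by (simp add: total_degree_monomial)
    qed
    then show ?thesis using G(3) by blast
  qed
  then have "{I :: 'k mpoly set. monomial_ideal d I \<and> ideal_degree d I \<le> n}
    \<subseteq> (\<lambda>G. Idl\<^bsub>poly_ring d\<^esub> G) ` Pow (?m ` ?S)" by blast
  then show ?thesis
    by (rule finite_subset) (intro finite_imageI finite_Pow_iff[THEN iffD2] finite_expos_bounded_degree)
qed

text \<open>Finite generation reduces this to up-sets of exponent vectors; inclusion of the up-sets
  gives inclusion of the ideals.\<close>

lemma monomial_ideals_descend:
  fixes I :: "nat \<Rightarrow> 'k::field mpoly set"
  assumes "\<And>i. monomial_ideal d (I i)"
  shows "\<exists>i j. i < j \<and> I j \<subseteq> I i"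
proof -
  let ?m = "\<lambda>e. Poly_Mapping.single e (1::'k)"
  have "\<exists>E. finite E \<and> E \<subseteq> {e. Poly_Mapping.keys e \<subseteq> vars d} \<and> I i = Idl\<^bsub>poly_ring d\<^esub> (?m ` E)" for i
    using monomial_ideal_finitely_generated[OF assms[of i]] unfolding monomials_def
    by (metis (no_types, lifting) finite_subset_image)
  then obtain E where E: "\<And>i. finite (E i)" "\<And>i. E i \<subseteq> {e. Poly_Mapping.keys e \<subseteq> vars d}"
    "\<And>i. I i = Idl\<^bsub>poly_ring d\<^esub> (?m ` E i)" by metis
  obtain i j where ij: "i < j" "\<forall>e\<in>Poly_Mapping.lookup ` E j. \<exists>e'\<in>Poly_Mapping.lookup ` E i.
      \<forall>v\<in>vars d. e' v \<le> e v"
    using generated_upsets_descend[OF finite_vars, of "\<lambda>i. Poly_Mapping.lookup ` E i" d] E(1) by blast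
  have "I j \<subseteq> I i"
    unfolding E(3) using E(2) ij(2) by (intro genideal_monomials_mono) auto
  with ij(1) show ?thesis by blast
qed

theorem mainTheorem1:
  shows "\<forall>d l. \<exists>M. \<forall>I :: nat \<Rightarrow> 'k::field mpoly set.
    (\<forall>i\<le>M. monomial_ideal d (I i) \<and> ideal_degree d (I i) \<le> l + i) \<longrightarrow>
    (\<exists>i j. i < j \<and> j \<le> M \<and> I i \<supseteq> I j)"
proof (intro allI, rule ccontr)
  fix d l
  define A :: "nat \<Rightarrow> 'k mpoly set set"
    where "A i = {I. monomial_ideal d I \<and> ideal_degree d I \<le> l + i}" for i
  assume "\<not> (\<exists>M. \<forall>I :: nat \<Rightarrow> 'k::field mpoly set.
    (\<forall>i\<le>M. monomial_ideal d (I i) \<and> ideal_degree d (I i) \<le> l + i) \<longrightarrow>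
    (\<exists>i j. i < j \<and> j \<le> M \<and> I i \<supseteq> I j))"
  \<comment> \<open>If no bound exists, there are bad sequences of every length; they form the rows
    of \<open>f\<close>.\<close>
  then have "\<forall>M. \<exists>I. (\<forall>i\<le>M. I i \<in> A i) \<and> (\<forall>i j. j \<le> M \<longrightarrow> i < j \<longrightarrow> \<not> I j \<subseteq> I i)"
    by (simp add: A_def)
  from choice[OF this] obtain f where
    "\<forall>M. (\<forall>i\<le>M. f M i \<in> A i) \<and> (\<forall>i j. j \<le> M \<longrightarrow> i < j \<longrightarrow> \<not> f M j \<subseteq> f M i)" ..
  then have f: "i \<le> M \<Longrightarrow> f M i \<in> A i" "i < j \<Longrightarrow> j \<le> M \<Longrightarrow> \<not> f M j \<subseteq> f M i" for M i j
    by simp_all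
  have "finite (A i)" for i
    unfolding A_def by (rule finite_monomial_ideals_bounded_degree)
  then obtain g where g: "\<And>n. \<exists>M\<ge>n. \<forall>i\<le>n. f M i = g i"
    using koenig_sequences[of A f] f(1) by blast
  have "monomial_ideal d (g i)" for i
    using g[of i] f(1)[of i] unfolding A_def by force
  then obtain i j where ij: "i < j" "g j \<subseteq> g i" using monomial_ideals_descend by blast
  \<comment> \<open>The inclusion found in the limit \<open>g\<close> involves only entries up to
    \<open>j\<close>, which \<open>g\<close> shares with some bad row.\<close>
  obtain M where "M \<ge> j" "\<forall>i\<le>j. f M i = g i" using g by blast
  then show False using f(2)[of i j M] ij by simp
qed

end
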